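(* Let $\mathbb{F}_q$ be a finite field of odd characteristic $p$, let $a,b\in\mathbb{F}_q$ with $b\ne 0$, and let $n\ge 2$, $t\ge 2$ be integers. Let $f_1,\dots,f_{t-1}\in\mathbb{F}_q[x]$ and let $C$ be the linear code over $\mathbb{F}_q$ with generator matrix $(I_n\ f_1(T_n(a,b,b))\ \cdots\ f_{t-1}(T_n(a,b,b)))$. Let $r$ be the largest integer such that $n+1=p^r(m+1)$ for an integer $m$. Let $\mu\in\mathbb{F}_{q^2}$ with $\mu^2=-1$. Then: (1) If $r=0$, let $\theta$ be a primitive $2(n+1)$-th root of $1$. Then $C$ is Euclidean LCD if and only if $$-1\notin\{f_1(a-b(\theta^i+\theta^{-i}))^2+\cdots+f_{t-1}(a-b(\theta^i+\theta^{-i}))^2:\ 1\le i\le n\}.$$ In particular, when $t=2$, $C$ is Euclidean LCD if and only if $$\mu\notin\{f_1(a-b(\theta^i+\theta^{-i})):1\le i\le n\}\cup\{-f_1(a-b(\theta^i+\theta^{-i})):1\le i\le n\}.$$ (2) If $r\ge 1$ and $m\ge 1$, let $\theta$ be a primitive $2(m+1)$-th root of $1$. Then $C$ is Euclidean LCD if and only if $$-1\notin\{f_1(a+2b)^2+\cdots+f_{t-1}(a+2b)^2,\ f_1(a-2b)^2+\cdots+f_{t-1}(a-2b)^2\}$$ $$\cup\ \{f_1(a-b(\theta^i+\theta^{-i}))^2+\cdots+f_{t-1}(a-b(\theta^i+\theta^{-i}))^2:\ 1\le i\le m\}.$$ In particular, when $t=2$, $C$ is Euclidean LCD if and only if $$\mu\notin\{f_1(a+2b),-f_1(a+2b),f_1(a-2b),-f_1(a-2b)\}$$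 $$\cup\ \{f_1(a-b(\theta^i+\theta^{-i})):1\le i\le m\}\cup\{-f_1(a-b(\theta^i+\theta^{-i})):1\le i\le m\}.$$ (3) If $r\ge 1$ and $m=0$, then $C$ is Euclidean LCD if and only if $$-1\notin\{f_1(a+2b)^2+\cdots+f_{t-1}(a+2b)^2,\ f_1(a-2b)^2+\cdots+f_{t-1}(a-2b)^2\}.$$ In particular, when $t=2$, $C$ is Euclidean LCD if and only if $$\mu\notin\{f_1(a+2b),-f_1(a+2b),f_1(a-2b),-f_1(a-2b)\}.$$
   Context: $T_n(a,b,c)$ denotes the $n\times n$ tridiagonal Toeplitz matrix with all diagonal entries equal to $a$, all subdiagonal entries equal to $b$, all superdiagonal entries equal to $c$, and all other entries $0$. $I_n$ is the identity matrix. Roots of unity are taken in an algebraic closure of $\mathbb{F}_q$. For a linear code $C\subseteq\mathbb{F}_q^N$, the Euclidean dual is $C^{\perp_E}=\{y\in\mathbb{F}_q^N:\sum_i x_iy_i=0 \text{ for all } x\in C\}$, and $C$ is Euclidean LCD if $C\cap C^{\perp_E}=\{0\}$. The code with generator matrix $G$ is the row space of $G$. *)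

theory Defs
  imports
    "Jordan_Normal_Form.VS_Connect"
    "HOL-Algebra.Algebraic_Closure_Type"
begin

definition tridiag_toeplitz :: "nat \<Rightarrow> 'a::zero \<Rightarrow> 'a \<Rightarrow> 'a \<Rightarrow> 'a mat" where
  "tridiag_toeplitz n a b c =
     mat n n (\<lambda>(i, j). if i = j then a
                       else if i = Suc j then b
                       else if j = Suc i then c
                       else 0)"

definition poly_mat :: "'a::comm_semiring_1 poly \<Rightarrow> 'a mat \<Rightarrow> 'a mat" where
  "poly_mat f A =
     mat (dim_row A) (dim_row A) (\<lambda>ij. \<Sum>k\<le>Polynomial.degree f. Polynomial.coeff f k * (A ^\<^sub>m k) $$ ij)"

text \<open>The block row \<open>(M 0  M 1  ...  M (t - 1))\<close> of \<open>n \<times> n\<close> matrices.\<close>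

definition block_row :: "nat \<Rightarrow> nat \<Rightarrow> (nat \<Rightarrow> 'a mat) \<Rightarrow> 'a mat" where
  "block_row n t M = mat n (t * n) (\<lambda>(i, j). M (j div n) $$ (i, j mod n))"

definition toeplitz_generator ::
    "nat \<Rightarrow> nat \<Rightarrow> 'a::comm_ring_1 \<Rightarrow> 'a \<Rightarrow> (nat \<Rightarrow> 'a poly) \<Rightarrow> 'a mat" where
  "toeplitz_generator n t a b f =
     block_row n t (\<lambda>l. if l = 0 then 1\<^sub>m n else poly_mat (f l) (tridiag_toeplitz n a b b))"

definition code_of :: "'a::field mat \<Rightarrow> 'a vec set" where
  "code_of G = vec_space.row_space (dim_col G) G"

text \<open>
  The library's orthogonal complement is taken with respect to the bilinear form
  \<open>\<Sum>i. x i * y i\<close>, so it is the Euclidean dual.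
\<close>

definition euclidean_LCD :: "nat \<Rightarrow> 'a::field vec set \<Rightarrow> bool" where
  "euclidean_LCD N C \<longleftrightarrow> C \<inter> vec_module.orthogonal_complement N C = {0\<^sub>v N}"

definition primitive_root_of_unity :: "nat \<Rightarrow> 'a::monoid_mult \<Rightarrow> bool" where
  "primitive_root_of_unity k z \<longleftrightarrow>
     k > 0 \<and> z ^ k = 1 \<and> (\<forall>j. 0 < j \<and> j < k \<longrightarrow> z ^ j \<noteq> 1)"

text \<open>
  With \<open>q\<close> the cardinality of the base field, the subfield of order \<open>q\<^sup>d\<close> of its algebraic
  closure is the set of roots of \<open>x ^ (q ^ d) - x\<close>.
\<close>

definition GF_ext :: "nat \<Rightarrow> 'a::finite_field alg_closure set" where
  "GF_ext d = {x. x ^ (card (UNIV :: 'a set) ^ d) = x}"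

definition poly_ac :: "'a::field poly \<Rightarrow> 'a alg_closure \<Rightarrow> 'a alg_closure" where
  "poly_ac f x = poly (map_poly to_ac f) x"

definition toeplitz_eigenvalue ::
    "'a::field \<Rightarrow> 'a \<Rightarrow> 'a alg_closure \<Rightarrow> nat \<Rightarrow> 'a alg_closure" where
  "toeplitz_eigenvalue a b \<theta> i = to_ac a - to_ac b * (\<theta> ^ i + inverse \<theta> ^ i)"

definition sum_squares :: "nat \<Rightarrow> (nat \<Rightarrow> 'a::field poly) \<Rightarrow> 'a alg_closure \<Rightarrow> 'a alg_closure" where
  "sum_squares t f x = (\<Sum>l = 1..t - 1. (poly_ac (f l) x)\<^sup>2)"

end

theory Submission
  imports Defs "Jordan_Normal_Form.Char_Poly"
begin

text \<open>
  The code is LCD iff the Gram matrix \<open>G G\<^sup>T\<close> is invertible. Since \<open>T = T\<^sub>n(a,b,b)\<close> is symmetric,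
  \<open>G G\<^sup>T = h(T)\<close> with \<open>h = 1 + f\<^sub>1\<^sup>2 + \<dots> + f\<^sub>t\<^sub>-\<^sub>1\<^sup>2\<close>, and over the algebraic closure \<open>h(T)\<close> is singular
  iff \<open>h\<close> vanishes at an eigenvalue of \<open>T\<close>. Writing a candidate eigenvalue as \<open>a + b (x + x\<^sup>-\<^sup>1)\<close>,
  the three-term recurrence for an eigenvector shows that it is an eigenvalue iff
  \<open>1 + x\<^sup>2 + \<dots> + x\<^sup>2\<^sup>n = 0\<close>; as \<open>n + 1 = p\<^sup>r (m + 1)\<close> with \<open>p\<close> not dividing \<open>m + 1\<close>, this says that
  \<open>x\<^sup>2 \<noteq> 1\<close> and \<open>x\<^sup>2\<^sup>(\<^sup>m\<^sup>+\<^sup>1\<^sup>) = 1\<close>, or that \<open>x = \<plusminus>1\<close> and \<open>r \<ge> 1\<close>. For \<open>m = 0\<close> the root of unity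
  \<open>\<theta> = -1\<close> makes the third case an instance of the second.
\<close>

section \<open>Polynomials evaluated at a square matrix\<close>

text \<open>Coefficients beyond the degree vanish, so the sum may run to any larger bound
  \<open>N\<close>; this gives polynomials of different degrees a common summation range.\<close>

lemma index_poly_mat:
  assumes "A \<in> carrier_mat n n" "i < n" "j < n" "Polynomial.degree f \<le> N"
  shows "poly_mat f A $$ (i, j) = (\<Sum>k\<le>N. Polynomial.coeff f k * (A ^\<^sub>m k) $$ (i, j))"
proof -
  have "(\<Sum>k\<le>Polynomial.degree f. Polynomial.coeff f k * (A ^\<^sub>m k) $$ (i, j))
      = (\<Sum>k\<le>N. Polynomial.coeff f k * (A ^\<^sub>m k) $$ (i, j))"
    using assms(4) by (intro sum.mono_neutral_left) (auto simp: coeff_eq_0)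
  then show ?thesis
    using assms(1-3) by (simp add: poly_mat_def)
qed

lemma poly_mat_carrier [simp]: "A \<in> carrier_mat n n \<Longrightarrow> poly_mat f A \<in> carrier_mat n n"
  by (auto simp: poly_mat_def)

lemma poly_mat_dim [simp]:
  "A \<in> carrier_mat n n \<Longrightarrow> dim_row (poly_mat f A) = n"
  "A \<in> carrier_mat n n \<Longrightarrow> dim_col (poly_mat f A) = n"
  by (auto simp: poly_mat_def)

lemma poly_mat_0 [simp]: "A \<in> carrier_mat n n \<Longrightarrow> poly_mat 0 A = 0\<^sub>m n n"
  by (auto simp: poly_mat_def)

lemma poly_mat_add:
  assumes A: "A \<in> carrier_mat n n"
  shows "poly_mat (f + g) A = poly_mat f A + poly_mat g A"
proof (rule eq_matI)
  fix i j assume "i < dim_row (poly_mat f A + poly_mat g A)" "j < dim_col (poly_mat f A + poly_mat g A)"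
  then have ij: "i < n" "j < n" using A by auto
  let ?N = "max (Polynomial.degree f) (Polynomial.degree g)"
  have "Polynomial.degree (f + g) \<le> ?N" by (rule degree_add_le_max)
  then show "poly_mat (f + g) A $$ (i, j) = (poly_mat f A + poly_mat g A) $$ (i, j)"
    using A ij by (simp add: index_poly_mat[where N = ?N] algebra_simps sum.distrib)
qed (use A in auto)

lemma poly_mat_smult:
  assumes A: "A \<in> carrier_mat n n"
  shows "poly_mat (Polynomial.smult c f) A = c \<cdot>\<^sub>m poly_mat f A"
proof (rule eq_matI)
  fix i j assume "i < dim_row (c \<cdot>\<^sub>m poly_mat f A)" "j < dim_col (c \<cdot>\<^sub>m poly_mat f A)"
  then have ij: "i < n" "j < n" using A by auto
  have "Polynomial.degree (Polynomial.smult c f) \<le> Polynomial.degree f" by (rule degree_smult_le)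
  then show "poly_mat (Polynomial.smult c f) A $$ (i, j) = (c \<cdot>\<^sub>m poly_mat f A) $$ (i, j)"
    using A ij by (simp add: index_poly_mat[where N = "Polynomial.degree f"] sum_distrib_left mult.assoc)
qed (use A in auto)

text \<open>The recursion of \<open>pow_mat\<close> puts the new factor on the right; the Horner
  rule and transposition need it on the left.\<close>

lemma pow_mat_Suc_left:
  assumes A: "(A :: 'a :: semiring_1 mat) \<in> carrier_mat n n"
  shows "A ^\<^sub>m Suc k = A * A ^\<^sub>m k"
proof (induct k)
  case (Suc k)
  have "A ^\<^sub>m Suc (Suc k) = (A * A ^\<^sub>m k) * A" using Suc by simp
  also have "\<dots> = A * A ^\<^sub>m Suc k"
    using A by (simp add: assoc_mult_mat[of _ n n _ n _ n] pow_carrier_mat)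
  finally show ?case .
qed (use A in auto)

text \<open>This is Horner's rule. It turns the entrywise definition of \<open>poly_mat\<close> into
  a recursion suited to induction over \<open>pCons\<close>.\<close>

lemma poly_mat_pCons:
  assumes A: "A \<in> carrier_mat n n"
  shows "poly_mat (pCons c f) A = c \<cdot>\<^sub>m 1\<^sub>m n + A * poly_mat f A" (is "_ = ?R")
proof (rule eq_matI)
  fix i j assume "i < dim_row ?R" "j < dim_col ?R"
  then have ij: "i < n" "j < n" using A by auto
  let ?d = "Polynomial.degree f"
  have [simp]: "A ^\<^sub>m k \<in> carrier_mat n n" for k using A by (rule pow_carrier_mat)
  have *: "(A ^\<^sub>m Suc k) $$ (i, j) = (\<Sum>l<n. A $$ (i, l) * (A ^\<^sub>m k) $$ (l, j))" for k
    using A ij by (simp add: pow_mat_Suc_left[OF A] scalar_prod_def lessThan_atLeast0 del: pow_mat.simps)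
  have "poly_mat (pCons c f) A $$ (i, j)
      = c * 1\<^sub>m n $$ (i, j) + (\<Sum>k\<le>?d. Polynomial.coeff f k * (A ^\<^sub>m Suc k) $$ (i, j))"
    using A ij degree_pCons_le[of c f]
    by (simp add: index_poly_mat[where N = "Suc ?d"] sum.atMost_Suc_shift del: sum.atMost_Suc)
  also have "(\<Sum>k\<le>?d. Polynomial.coeff f k * (A ^\<^sub>m Suc k) $$ (i, j))
      = (\<Sum>l<n. A $$ (i, l) * (\<Sum>k\<le>?d. Polynomial.coeff f k * (A ^\<^sub>m k) $$ (l, j)))"
    unfolding * sum_distrib_left by (subst sum.swap) (simp add: mult_ac)
  also have "\<dots> = (A * poly_mat f A) $$ (i, j)"
    using A ij by (simp add: scalar_prod_def lessThan_atLeast0 index_poly_mat[where N = ?d])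
  finally show "poly_mat (pCons c f) A $$ (i, j) = ?R $$ (i, j)" using A ij by simp
qed (use A in auto)

lemma poly_mat_const: "A \<in> carrier_mat n n \<Longrightarrow> poly_mat [:c:] A = c \<cdot>\<^sub>m 1\<^sub>m n"
  by (simp add: poly_mat_pCons right_add_zero_mat[of _ n n])

lemma poly_mat_mult:
  assumes A: "A \<in> carrier_mat n n"
  shows "poly_mat (f * g) A = poly_mat f A * poly_mat g A"
proof (induct f)
  case (pCons c f)
  let ?F = "poly_mat f A" and ?G = "poly_mat g A"
  have c: "?F \<in> carrier_mat n n" "?G \<in> carrier_mat n n" using A by auto
  have "poly_mat (pCons c f * g) A = c \<cdot>\<^sub>m ?G + (0 \<cdot>\<^sub>m 1\<^sub>m n + A * (?F * ?G))"
    using A by (simp add: poly_mat_add poly_mat_smult poly_mat_pCons pCons)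
  \<comment> \<open>The zero summand is the constant term of \<open>pCons 0 (f * g)\<close>, which
    arises from \<open>pCons c f * g\<close>.\<close>
  also have "0 \<cdot>\<^sub>m 1\<^sub>m n + A * (?F * ?G) = A * ?F * ?G"
    using A c by (subst assoc_mult_mat[of A n n ?F n ?G n]) (auto intro!: eq_matI)
  also have "c \<cdot>\<^sub>m ?G + A * ?F * ?G = (c \<cdot>\<^sub>m 1\<^sub>m n + A * ?F) * ?G"
    using A c by (subst add_mult_distrib_mat[of _ n n _ ?G n]) 
      (auto simp: mult_smult_assoc_mat[of _ n n _ n])
  finally show ?case using A by (simp add: poly_mat_pCons)
qed (use A in auto)

text \<open>Stated for entries because matrices of all sizes share one type, so no single zero
  matrix can serve as the empty sum.\<close>

lemma index_poly_mat_sum: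
  assumes A: "A \<in> carrier_mat n n" and ij: "i < n" "j < n"
  shows "poly_mat (\<Sum>l\<in>S. g l) A $$ (i, j) = (\<Sum>l\<in>S. poly_mat (g l) A $$ (i, j))"
  using A ij by (induct S rule: infinite_finite_induct) (simp_all add: poly_mat_add)

text \<open>Transposition reverses products, which does not matter for powers of a single
  matrix.\<close>

lemma poly_mat_transpose:
  assumes A: "A \<in> carrier_mat n n" 
  shows "(poly_mat f A)\<^sup>T = poly_mat f A\<^sup>T"
proof -
  have T: "A\<^sup>T \<in> carrier_mat n n" using A by simp
  have *: "(A ^\<^sub>m k)\<^sup>T = A\<^sup>T ^\<^sub>m k" for k
  proof (induct k)
    case (Suc k)
    have "(A ^\<^sub>m Suc k)\<^sup>T = A\<^sup>T * (A ^\<^sub>m k)\<^sup>T"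
      using A by (simp add: transpose_mult[of _ n n _ n] pow_carrier_mat)
    then show ?case by (simp only: Suc pow_mat_Suc_left[OF T])
  qed (use A in simp)
  show ?thesis
  proof (rule eq_matI)
    fix i j assume "i < dim_row (poly_mat f A\<^sup>T)" "j < dim_col (poly_mat f A\<^sup>T)"
    then have ij: "i < n" "j < n" using T by auto
    have "(A\<^sup>T ^\<^sub>m k) $$ (i, j) = (A ^\<^sub>m k) $$ (j, i)" for k
      unfolding *[symmetric] using A ij by simp
    then show "(poly_mat f A)\<^sup>T $$ (i, j) = poly_mat f A\<^sup>T $$ (i, j)"
      using A T ij by (simp add: index_poly_mat[where N = "Polynomial.degree f"])
  qed (use A T in auto)
qed

section \<open>Singularity of a polynomial in a matrix\<close>

text \<open>Over an algebraically closed field \<open>h\<close> splits into linear factors. Each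
  factor contributes the determinant of some \<open>char_matrix A x\<close>, which vanishes exactly
  at eigenvalues, and determinants multiply.\<close>

lemma det_poly_mat_eq_0_iff:
  fixes A :: "'a :: alg_closed_field mat"
  assumes A: "A \<in> carrier_mat n n" and n: "n > 0"
  shows "Determinant.det (poly_mat h A) = 0 \<longleftrightarrow> (\<exists>x. eigenvalue A x \<and> poly h x = 0)"
proof (cases "h = 0")
  case True
  \<comment> \<open>For \<open>h = 0\<close> both sides hold: the zero matrix of positive size is
    singular, and some eigenvalue exists.\<close>
  have "Polynomial.degree (char_poly A) > 0" using degree_monic_char_poly[OF A] n by simp
  then obtain x where "eigenvalue A x"
    using alg_closed_imp_poly_has_root eigenvalue_root_char_poly[OF A] by blast
  then show ?thesis using True A n by (auto simp: det_zero)
next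
  case False
  then show ?thesis
  proof (induct "Polynomial.degree h" arbitrary: h)
    case 0
    then obtain c where "h = [:c:]" by (metis degree_eq_zeroE)
    with 0 A show ?case by (auto simp: poly_mat_const)
  next
    case (Suc d)
    then obtain x where x: "poly h x = 0" using alg_closed_imp_poly_has_root[of h] by auto
    then obtain g where h: "h = [:-x, 1:] * g" by (auto simp: poly_eq_0_iff_dvd elim: dvdE)
    with Suc.prems have "g \<noteq> 0" by auto
    moreover have "Polynomial.degree h = Suc (Polynomial.degree g)"
      unfolding h using \<open>g \<noteq> 0\<close> by (subst degree_mult_eq) auto
    ultimately have g: "g \<noteq> 0" "Polynomial.degree g = d" using Suc.hyps(2) by auto
    have "poly_mat [:-x, 1:] A = char_matrix A x"
      using A by (auto simp: poly_mat_pCons char_matrix_def intro!: eq_matI)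
    then have "Determinant.det (poly_mat h A)
        = Determinant.det (char_matrix A x) * Determinant.det (poly_mat g A)"
      unfolding h poly_mat_mult[OF A] using A by (simp add: det_mult[of _ n])
    then show ?case
      using Suc(1)[of g] g eigenvalue_det[OF A, of x] by (auto simp: h)
  qed
qed

section \<open>The Gram matrix criterion for LCD codes\<close>

text \<open>Codewords are the vectors \<open>G\<^sup>T *\<^sub>v u\<close>, and such a word lies in
  the dual iff the Gram matrix kills \<open>u\<close>. Full rank, phrased as injectivity of
  \<open>G\<^sup>T\<close>, matches nonzero \<open>u\<close> with nonzero codewords.\<close>

lemma euclidean_LCD_code_of_iff:
  fixes G :: "'a::field mat"
  assumes G: "G \<in> carrier_mat k N"
    and full_rank: "\<And>u. u \<in> carrier_vec k \<Longrightarrow> G\<^sup>T *\<^sub>v u = 0\<^sub>v N \<Longrightarrow> u = 0\<^sub>v k"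
  shows "euclidean_LCD N (code_of G) \<longleftrightarrow> Determinant.det (G * G\<^sup>T) \<noteq> 0"
proof -
  have T: "G\<^sup>T \<in> carrier_mat N k" using G by simp
  have code: "code_of G = {G\<^sup>T *\<^sub>v u | u. u \<in> carrier_vec k}"
  proof -
    have "code_of G = {w \<in> carrier_vec N. \<exists>y\<in>carrier_vec k. G\<^sup>T *\<^sub>v y = w}"
      using vec_space.row_space_eq[OF G] G by (simp add: code_of_def)
    then show ?thesis using T by auto
  qed
  have dual: "vec_module.orthogonal_complement N (code_of G) = {y \<in> carrier_vec N. G *\<^sub>v y = 0\<^sub>v k}"
    (is "_ = ?R")
  proof (intro equalityI subsetI)
    fix y assume "y \<in> vec_module.orthogonal_complement N (code_of G)"
    then have y: "y \<in> carrier_vec N" "\<And>u. u \<in> carrier_vec k \<Longrightarrow> y \<bullet> (G\<^sup>T *\<^sub>v u) = 0"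
      unfolding vec_module.orthogonal_complement_def code by auto
    \<comment> \<open>Orthogonality to the codeword of a unit vector, that is, to a row of
      \<open>G\<close>, reads off one coordinate of \<open>G *\<^sub>v y\<close>.\<close>
    have "(G *\<^sub>v y) $ i = 0" if i: "i < k" for i
    proof -
      have "y \<bullet> (G\<^sup>T *\<^sub>v unit_vec k i) = (G\<^sup>T *\<^sub>v unit_vec k i) \<bullet> y"
        by (rule comm_scalar_prod[of _ N]) (use y T in auto)
      also have "\<dots> = unit_vec k i \<bullet> (G *\<^sub>v y)"
        by (rule transpose_vec_mult_scalar[OF G]) (use y in auto)
      also have "\<dots> = (G *\<^sub>v y) $ i" using G y i by (simp add: scalar_prod_left_unit[of _ k])
      finally show ?thesis using y(2)[of "unit_vec k i"] by simp
    qed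
    then show "y \<in> ?R" using y G by auto
  next
    fix y assume y: "y \<in> ?R"
    have "y \<bullet> (G\<^sup>T *\<^sub>v u) = 0" if u: "u \<in> carrier_vec k" for u
    proof -
      have "y \<bullet> (G\<^sup>T *\<^sub>v u) = (G\<^sup>T *\<^sub>v u) \<bullet> y"
        by (rule comm_scalar_prod[of _ N]) (use y T u in auto)
      also have "\<dots> = u \<bullet> (G *\<^sub>v y)"
        by (rule transpose_vec_mult_scalar[OF G]) (use y u in auto)
      finally show ?thesis using y u by simp
    qed
    then show "y \<in> vec_module.orthogonal_complement N (code_of G)"
      using y unfolding vec_module.orthogonal_complement_def code by auto
  qed
  have assoc: "(G * G\<^sup>T) *\<^sub>v u = G *\<^sub>v (G\<^sup>T *\<^sub>v u)" if "u \<in> carrier_vec k" for u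
    using G T that by (rule assoc_mult_mat_vec)
  have GG: "G * G\<^sup>T \<in> carrier_mat k k" using G by simp
  show ?thesis
    unfolding euclidean_LCD_def dual det_0_iff_vec_prod_zero[OF GG]
  proof (intro iffI notI)
    assume L: "code_of G \<inter> ?R = {0\<^sub>v N}"
      and "\<exists>v. v \<in> carrier_vec k \<and> v \<noteq> 0\<^sub>v k \<and> G * G\<^sup>T *\<^sub>v v = 0\<^sub>v k"
    then obtain v where v: "v \<in> carrier_vec k" "v \<noteq> 0\<^sub>v k" "G *\<^sub>v (G\<^sup>T *\<^sub>v v) = 0\<^sub>v k"
      using assoc by auto
    then have "G\<^sup>T *\<^sub>v v \<in> code_of G \<inter> ?R" using T unfolding code by auto
    with L v full_rank show False by auto
  next
    assume "\<not> (\<exists>v. v \<in> carrier_vec k \<and> v \<noteq> 0\<^sub>v k \<and> G * G\<^sup>T *\<^sub>v v = 0\<^sub>v k)"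
    then have inj: "u = 0\<^sub>v k" if "u \<in> carrier_vec k" "G *\<^sub>v (G\<^sup>T *\<^sub>v u) = 0\<^sub>v k" for u
      using that assoc by auto
    have z: "G\<^sup>T *\<^sub>v 0\<^sub>v k = 0\<^sub>v N" "G *\<^sub>v 0\<^sub>v N = 0\<^sub>v k" using G by auto
    then have "0\<^sub>v N \<in> code_of G \<inter> ?R" unfolding code by (auto intro!: exI[of _ "0\<^sub>v k"])
    then show "code_of G \<inter> ?R = {0\<^sub>v N}"
      using inj z T unfolding code by auto
  qed
qed

section \<open>The Gram matrix of the Toeplitz generator\<close>

lemma tridiag_toeplitz_carrier [simp]: "tridiag_toeplitz n a b c \<in> carrier_mat n n"
  by (simp add: tridiag_toeplitz_def)

lemma tridiag_toeplitz_symmetric: "(tridiag_toeplitz n a b b)\<^sup>T = tridiag_toeplitz n a b b"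
  by (intro eq_matI) (auto simp: tridiag_toeplitz_def)

text \<open>The inner product over \<open>t * n\<close> columns splits into \<open>t\<close>
  consecutive stretches of length \<open>n\<close>; on stretch \<open>l\<close> the block index
  \<open>k div n\<close> is constantly \<open>l\<close>.\<close>

lemma block_row_mult_transpose_index:
  fixes M :: "nat \<Rightarrow> 'a::comm_semiring_0 mat"
  assumes M: "\<And>l. l < t \<Longrightarrow> M l \<in> carrier_mat n n" and ij: "i < n" "j < n"
  shows "(block_row n t M * (block_row n t M)\<^sup>T) $$ (i, j) = (\<Sum>l<t. (M l * (M l)\<^sup>T) $$ (i, j))"
proof -
  let ?g = "\<lambda>k. M (k div n) $$ (i, k mod n) * M (k div n) $$ (j, k mod n)"
  have "(block_row n t M * (block_row n t M)\<^sup>T) $$ (i, j) = sum ?g {..<t * n}"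
    using ij by (simp add: block_row_def scalar_prod_def lessThan_atLeast0)
  also have "\<dots> = (\<Sum>l<t. sum ?g {l * n..<l * n + n})"
    by (simp add: sum.nat_group)
  also have "\<dots> = (\<Sum>l<t. (M l * (M l)\<^sup>T) $$ (i, j))"
  proof (rule sum.cong [OF refl])
    fix l assume "l \<in> {..<t}"
    then have l: "M l \<in> carrier_mat n n" using M by simp
    have "sum ?g {l * n..<l * n + n} = (\<Sum>k\<in>{0..<n}. ?g (k + l * n))"
      using sum.shift_bounds_nat_ivl[of ?g 0 "l * n" n] by (simp add: add.commute)
    also have "\<dots> = (M l * (M l)\<^sup>T) $$ (i, j)"
      using l ij by (simp add: scalar_prod_def)
    finally show "sum ?g {l * n..<l * n + n} = (M l * (M l)\<^sup>T) $$ (i, j)" .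
  qed
  finally show ?thesis .
qed

text \<open>Symmetry of the Toeplitz matrix makes each block symmetric, so block \<open>l\<close>
  contributes the square of \<open>f l\<close> at that matrix; the identity block contributes the
  summand 1.\<close>

lemma toeplitz_generator_mult_transpose:
  fixes a b :: "'a::comm_ring_1"
  assumes t: "t \<ge> 1"
  shows "toeplitz_generator n t a b f * (toeplitz_generator n t a b f)\<^sup>T
    = poly_mat (1 + (\<Sum>l = 1..t - 1. (f l)\<^sup>2)) (tridiag_toeplitz n a b b)"
    (is "?G * ?G\<^sup>T = poly_mat _ ?T")
proof (rule eq_matI)
  have T: "?T \<in> carrier_mat n n" by simp
  fix i j assume "i < dim_row (poly_mat (1 + (\<Sum>l = 1..t - 1. (f l)\<^sup>2)) ?T)"
    "j < dim_col (poly_mat (1 + (\<Sum>l = 1..t - 1. (f l)\<^sup>2)) ?T)"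
  then have ij: "i < n" "j < n" by (simp_all only: poly_mat_dim[OF T])
  let ?M = "\<lambda>l. if l = 0 then 1\<^sub>m n else poly_mat (f l) ?T"
  have sq: "?M l * (?M l)\<^sup>T = poly_mat (if l = 0 then 1 else (f l)\<^sup>2) ?T" for l
  proof (cases "l = 0")
    case True
    then show ?thesis by (auto simp: one_pCons poly_mat_const[OF T] intro!: eq_matI)
  next
    case False
    then show ?thesis
      by (simp add: power2_eq_square poly_mat_mult[OF T] poly_mat_transpose[OF T] tridiag_toeplitz_symmetric)
  qed
  have "(?G * ?G\<^sup>T) $$ (i, j) = (\<Sum>l<t. (?M l * (?M l)\<^sup>T) $$ (i, j))"
    unfolding toeplitz_generator_def by (rule block_row_mult_transpose_index) (use ij T in auto)
  also have "\<dots> = (\<Sum>l<t. poly_mat (if l = 0 then 1 else (f l)\<^sup>2) ?T $$ (i, j))"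
    unfolding sq ..
  also have "\<dots> = poly_mat (\<Sum>l<t. if l = 0 then 1 else (f l)\<^sup>2) ?T $$ (i, j)"
    by (rule index_poly_mat_sum[OF T ij, symmetric])
  also have "(\<Sum>l<t. if l = 0 then 1 else (f l)\<^sup>2) = 1 + (\<Sum>l = 1..t - 1. (f l)\<^sup>2)"
  proof -
    have "{..<t} = insert 0 {1..t - 1}" using t by auto
    then show ?thesis by simp
  qed
  finally show "(?G * ?G\<^sup>T) $$ (i, j) = poly_mat (1 + (\<Sum>l = 1..t - 1. (f l)\<^sup>2)) ?T $$ (i, j)" .
qed (simp_all add: toeplitz_generator_def block_row_def poly_mat_dim[of _ n])

section \<open>Passage to the algebraic closure\<close>

lemma field_hom_to_ac: "field_hom to_ac"
  by unfold_locales auto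

lemma map_mat_poly_mat_to_ac:
  assumes A: "A \<in> carrier_mat n n"
  shows "map_mat to_ac (poly_mat f A) = poly_mat (map_poly to_ac f) (map_mat to_ac A)"
proof -
  interpret to_ac: field_hom to_ac by (rule field_hom_to_ac)
  have A': "map_mat to_ac A \<in> carrier_mat n n" using A by simp
  show ?thesis
  proof (rule eq_matI)
    fix i j assume "i < dim_row (poly_mat (map_poly to_ac f) (map_mat to_ac A))"
      "j < dim_col (poly_mat (map_poly to_ac f) (map_mat to_ac A))"
    then have ij: "i < n" "j < n" using A' by auto
    have d: "Polynomial.degree (map_poly to_ac f) \<le> Polynomial.degree f" by (rule degree_map_poly_le)
    show "map_mat to_ac (poly_mat f A) $$ (i, j) = poly_mat (map_poly to_ac f) (map_mat to_ac A) $$ (i, j)"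
      using ij A index_poly_mat[OF A' ij d] index_poly_mat[OF A ij order_refl] pow_carrier_mat[OF A]
      by (simp add: to_ac_sum coeff_map_poly flip: to_ac.mat_hom_pow[OF A])
  qed (use A A' in auto)
qed

lemma euclidean_LCD_iff_eigenvalue:
  fixes a b :: "'a::field"
  assumes n: "n \<ge> 1" and t: "t \<ge> 1"
  shows "euclidean_LCD (t * n) (code_of (toeplitz_generator n t a b f)) \<longleftrightarrow>
    \<not> (\<exists>x. eigenvalue (tridiag_toeplitz n (to_ac a) (to_ac b) (to_ac b)) x \<and> sum_squares t f x = -1)"
proof -
  interpret to_ac: field_hom to_ac by (rule field_hom_to_ac)
  interpret to_ac_poly: map_poly_comm_ring_hom to_ac ..
  let ?G = "toeplitz_generator n t a b f" and ?h = "1 + (\<Sum>l = 1..t - 1. (f l)\<^sup>2)"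
  let ?T = "tridiag_toeplitz n a b b" and ?T' = "tridiag_toeplitz n (to_ac a) (to_ac b) (to_ac b)"
  have G: "?G \<in> carrier_mat n (t * n)" by (simp add: toeplitz_generator_def block_row_def)
  have "euclidean_LCD (t * n) (code_of ?G) \<longleftrightarrow> Determinant.det (?G * ?G\<^sup>T) \<noteq> 0"
  proof (rule euclidean_LCD_code_of_iff[OF G])
    fix u assume u: "u \<in> carrier_vec n" and 0: "?G\<^sup>T *\<^sub>v u = 0\<^sub>v (t * n)"
    show "u = 0\<^sub>v n"
    proof (rule eq_vecI)
      fix j assume "j < dim_vec (0\<^sub>v n :: 'a vec)"
      then have j: "j < n" and jt: "j < t * n" using t by (auto intro: less_le_trans)
      \<comment> \<open>The first \<open>n\<close> coordinates belong to the identity block and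
        reproduce \<open>u\<close>, whence full rank.\<close>
      have "0 = (?G\<^sup>T *\<^sub>v u) $ j" using 0 jt by simp
      also have "\<dots> = (\<Sum>i = 0..<n. (if i = j then 1 else 0) * u $ i)"
        using jt j u by (auto simp: scalar_prod_def toeplitz_generator_def block_row_def intro!: sum.cong)
      also have "\<dots> = u $ j" using j by (simp add: if_distrib[of "\<lambda>x. x * _"] cong: if_cong)
      finally show "u $ j = 0\<^sub>v n $ j" using j by simp
    qed (use u in simp)
  qed
  also have "?G * ?G\<^sup>T = poly_mat ?h ?T"
    using t by (rule toeplitz_generator_mult_transpose)
  \<comment> \<open>The embedding \<open>to_ac\<close> is injective and commutes with determinants,
    so singularity may be tested where \<open>h\<close> splits.\<close>
  also have "Determinant.det (poly_mat ?h ?T) = 0 \<longleftrightarrow> Determinant.det (map_mat to_ac (poly_mat ?h ?T)) = 0"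
    by simp
  also have "map_mat to_ac (poly_mat ?h ?T) = poly_mat (map_poly to_ac ?h) ?T'"
  proof -
    have "map_mat to_ac ?T = ?T'" by (intro eq_matI) (auto simp: tridiag_toeplitz_def)
    then show ?thesis by (simp add: map_mat_poly_mat_to_ac[of _ n])
  qed
  also have "Determinant.det (poly_mat (map_poly to_ac ?h) ?T') = 0 \<longleftrightarrow>
      (\<exists>x. eigenvalue ?T' x \<and> poly (map_poly to_ac ?h) x = 0)"
    by (rule det_poly_mat_eq_0_iff[of _ n]) (use n in auto)
  also have "(\<lambda>x. poly (map_poly to_ac ?h) x) = (\<lambda>x. 1 + sum_squares t f x)"
    by (simp add: sum_squares_def poly_ac_def to_ac_poly.hom_add to_ac_poly.hom_sum to_ac_poly.hom_power poly_sum)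
  finally show ?thesis by (simp add: add_eq_0_iff)
qed

section \<open>Eigenvectors and the three-term recurrence\<close>

text \<open>The sequence \<open>w\<close> is \<open>v\<close> shifted to positions 1 to
  \<open>n\<close> and padded by zeros. The padding at 0 and \<open>n + 1\<close> lets the first and
  last rows obey the same formula as the others.\<close>

lemma tridiag_toeplitz_mult_vec_index:
  fixes a b c :: "'a::comm_semiring_1" and v :: "'a vec"
  assumes v: "v \<in> carrier_vec n" and i: "i < n"
    and w: "\<And>j. w j = (if 1 \<le> j \<and> j \<le> n then v $ (j - 1) else 0)"
  shows "(tridiag_toeplitz n a b c *\<^sub>v v) $ i = b * w i + a * w (i + 1) + c * w (i + 2)"
proof -
  have "(tridiag_toeplitz n a b c *\<^sub>v v) $ i = (\<Sum>j = 0..<n.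
      (if i = j then a else if i = Suc j then b else if j = Suc i then c else 0) * v $ j)"
    using v i by (simp add: tridiag_toeplitz_def scalar_prod_def)
  also have "\<dots> = (\<Sum>j = 0..<n. (if i = Suc j then b * v $ j else 0)
      + (if j = i then a * v $ j else 0) + (if j = Suc i then c * v $ j else 0))"
    by (intro sum.cong) auto
  also have "(\<Sum>j = 0..<n. (if i = Suc j then b * v $ j else 0)
      + (if j = i then a * v $ j else 0) + (if j = Suc i then c * v $ j else 0))
      = (\<Sum>j = 0..<n. if i = Suc j then b * v $ j else 0) + a * w (i + 1) + c * w (i + 2)"
    using i by (simp add: sum.distrib w)
  also have "(\<Sum>j = 0..<n. if i = Suc j then b * v $ j else 0) = b * w i"
    using i by (cases i) (simp_all add: w)
  finally show ?thesis .
qed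

text \<open>After division by \<open>b\<close> the eigenvector equation is a recurrence whose
  solutions starting at 0 are the multiples of \<open>U\<close>. The remaining boundary condition at
  \<open>n + 1\<close> is the vanishing of \<open>U (n + 1)\<close>.\<close>

lemma eigenvalue_tridiag_toeplitz_iff:
  fixes a b x y :: "'a::field"
  assumes b: "b \<noteq> 0" and n: "n \<ge> 1" and xy: "x * y = 1"
  shows "eigenvalue (tridiag_toeplitz n a b b) (a + b * (x + y)) \<longleftrightarrow> (\<Sum>k\<le>n. (x\<^sup>2) ^ k) = 0"
proof -
  let ?T = "tridiag_toeplitz n a b b"
  \<comment> \<open>This is the Chebyshev polynomial of the second kind in disguise,
    \<open>(x ^ j - y ^ j) / (x - y)\<close> when \<open>x\<close> and \<open>y\<close> differ; the
    sum form also covers \<open>x = y\<close>.\<close>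
  define U where "U j = y ^ (j - 1) * (\<Sum>k<j. (x\<^sup>2) ^ k)" for j
  have U0: "U 0 = 0" "U 1 = 1" by (simp_all add: U_def)
  have U_rec: "U (j + 2) = (x + y) * U (j + 1) - U j" for j
  \<comment> \<open>The exponent \<open>j - 1\<close> is truncated at \<open>j = 0\<close>, so that
    case is checked by itself.\<close>
  proof (cases j)
    case 0
    then show ?thesis using xy by (simp add: U_def algebra_simps power2_eq_square)
  next
    case (Suc i)
    define S where "S = (\<Sum>k<Suc i. (x\<^sup>2) ^ k)"
    define e where "e = (x\<^sup>2) ^ Suc i"
    have "U (j + 2) = y ^ i * (y\<^sup>2 * S + y\<^sup>2 * e + (x * y)\<^sup>2 * e)"
      by (simp add: U_def Suc S_def e_def algebra_simps power2_eq_square)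
    moreover have "U (j + 1) = y ^ i * (y * (S + e))"
      by (simp add: U_def Suc S_def e_def algebra_simps power2_eq_square)
    moreover have "U j = y ^ i * S" by (simp add: U_def Suc S_def)
    moreover have "(x + y) * (y ^ i * (y * (S + e))) = y ^ i * ((x * y + y\<^sup>2) * (S + e))"
      by (simp add: algebra_simps power2_eq_square)
    ultimately show ?thesis by (simp add: xy algebra_simps)
  qed
  have y0: "y \<noteq> 0" using xy by auto
  have U_end: "U (n + 1) = 0 \<longleftrightarrow> (\<Sum>k\<le>n. (x\<^sup>2) ^ k) = 0"
    using y0 by (simp add: U_def lessThan_Suc_atMost del: sum.lessThan_Suc)
  show ?thesis unfolding U_end[symmetric]
  proof
    assume "eigenvalue ?T (a + b * (x + y))"
    then obtain v :: "'a vec" where v: "v \<in> carrier_vec n" "v \<noteq> 0\<^sub>v n" "?T *\<^sub>v v = (a + b * (x + y)) \<cdot>\<^sub>v v"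
      by (auto simp: eigenvalue_def eigenvector_def tridiag_toeplitz_def)
    define w where "w j = (if 1 \<le> j \<and> j \<le> n then v $ (j - 1) else 0)" for j
    have w_rec: "w (j + 2) = (x + y) * w (j + 1) - w j" if j: "j < n" for j
    proof -
      have "b * w j + a * w (j + 1) + b * w (j + 2) = (?T *\<^sub>v v) $ j"
        by (rule tridiag_toeplitz_mult_vec_index[symmetric]) (use v j w_def in auto)
      also have "\<dots> = (a + b * (x + y)) * w (j + 1)" using v j by (simp add: w_def)
      finally have "b * w (j + 2) = b * ((x + y) * w (j + 1) - w j)" by (simp add: algebra_simps)
      with b show ?thesis by simp
    qed
    \<comment> \<open>Both sequences vanish at 0 and satisfy the same second-order recurrence, so
      they are proportional.\<close>
    have wU: "j \<le> n + 1 \<Longrightarrow> w j = w 1 * U j" for j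
    proof (induct j rule: less_induct)
      case (less j)
      consider "j = 0" | "j = 1" | i where "j = i + 2"
        by (metis One_nat_def Suc_1 add.commute add_2_eq_Suc not0_implies_Suc)
      then show ?case
      proof cases
        case 3
        have "w j = (x + y) * w (i + 1) - w i" using 3 less(2) w_rec[of i] by simp
        also have "\<dots> = (x + y) * (w 1 * U (i + 1)) - w 1 * U i"
          using less(1)[of i] less(1)[of "i + 1"] 3 less(2) by simp
        also have "\<dots> = w 1 * U j" unfolding 3 U_rec by (simp add: algebra_simps)
        finally show ?thesis .
      qed (use U0 in \<open>simp_all add: w_def\<close>)
    qed
    have "w 1 \<noteq> 0"
    proof
      assume "w 1 = 0"
      then have "v $ j = 0" if "j < n" for j using wU[of "j + 1"] that by (simp add: w_def)
      with v show False by (metis eq_vecI carrier_vecD index_zero_vec)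
    qed
    moreover have "w (n + 1) = 0" by (simp add: w_def)
    ultimately show "U (n + 1) = 0" using wU[of "n + 1"] by simp
  next
    assume U: "U (n + 1) = 0"
    let ?v = "Matrix.vec n (\<lambda>j. U (j + 1))"
    \<comment> \<open>Since \<open>U\<close> vanishes at 0 and \<open>n + 1\<close>, it coincides
      there with the zero padding of \<open>?v\<close>; the rows reach no index above
      \<open>n + 1\<close>, so the cutoff is harmless.\<close>
    have w: "(if j \<le> n + 1 then U j else 0) = (if 1 \<le> j \<and> j \<le> n then ?v $ (j - 1) else 0)" for j
      using U U0 by (cases "j = n + 1") (auto simp: not_less_eq_eq)
    have "(?T *\<^sub>v ?v) $ j = ((a + b * (x + y)) \<cdot>\<^sub>v ?v) $ j" if j: "j < n" for j
    proof -
      have "(?T *\<^sub>v ?v) $ j = b * U j + a * U (j + 1) + b * U (j + 2)"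
        using tridiag_toeplitz_mult_vec_index[OF _ j w, of a b b] j by simp
      also have "\<dots> = (a + b * (x + y)) * U (j + 1)"
        unfolding U_rec by (simp add: algebra_simps)
      finally show ?thesis using j by simp
    qed
    then have "?T *\<^sub>v ?v = (a + b * (x + y)) \<cdot>\<^sub>v ?v"
      by (intro eq_vecI) (auto simp: tridiag_toeplitz_def)
    moreover have "?v \<noteq> 0\<^sub>v n"
    proof
      assume "?v = 0\<^sub>v n"
      then have "?v $ 0 = 0\<^sub>v n $ 0" by simp
      with n U0 show False by simp
    qed
    ultimately show "eigenvalue ?T (a + b * (x + y))"
      by (auto simp: eigenvalue_def eigenvector_def tridiag_toeplitz_def intro!: exI[of _ ?v])
  qed
qed

section \<open>Geometric sums and roots of unity\<close>

text \<open>By the Frobenius identity, \<open>z ^ (p ^ r) - 1 = (z - 1) ^ (p ^ r)\<close> in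
  characteristic \<open>p\<close>.\<close>

lemma power_CHAR_power_eq_1_iff:
  fixes z :: "'a::idom"
  assumes "Factorial_Ring.prime CHAR('a)"
  shows "z ^ (CHAR('a) ^ r) = 1 \<longleftrightarrow> z = 1"
proof -
  have "((z - 1) + 1) ^ (CHAR('a) ^ r) = (z - 1) ^ (CHAR('a) ^ r) + 1 ^ (CHAR('a) ^ r)"
    by (rule freshmans_dream') (use assms in auto)
  then show ?thesis using assms by (auto simp: prime_gt_0_nat)
qed

text \<open>At \<open>z = 1\<close> the sum is the image of \<open>n + 1\<close>, which vanishes iff
  the characteristic divides it. Elsewhere it vanishes iff \<open>z ^ (n + 1) = 1\<close>, and
  Frobenius strips the factor \<open>CHAR('a) ^ r\<close> from the exponent.\<close>

lemma geometric_sum_eq_0_iff: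
  fixes z :: "'a::field"
  assumes p: "Factorial_Ring.prime CHAR('a)" and n: "n + 1 = CHAR('a) ^ r * (m + 1)" and m: "\<not> CHAR('a) dvd m + 1"
  shows "(\<Sum>k\<le>n. z ^ k) = 0 \<longleftrightarrow> (if z = 1 then r \<ge> 1 else z ^ (m + 1) = 1)"
proof (cases "z = 1")
  case True
  have "(\<Sum>k\<le>n. z ^ k) = of_nat (n + 1)" using True by simp
  also have "\<dots> = 0 \<longleftrightarrow> CHAR('a) dvd n + 1" by (rule of_nat_eq_0_iff_char_dvd)
  also have "\<dots> \<longleftrightarrow> r \<ge> 1"
  proof (cases r)
    case 0
    then show ?thesis using m n by simp
  next
    case (Suc r')
    then show ?thesis unfolding n by simp
  qed
  finally show ?thesis using True by simp
next
  case False
  have "(1 - z) * (\<Sum>k\<le>n. z ^ k) = 1 - z ^ (n + 1)"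
    using one_diff_power_eq[of z "n + 1"] by (simp add: lessThan_Suc_atMost)
  then have "(\<Sum>k\<le>n. z ^ k) = 0 \<longleftrightarrow> z ^ (n + 1) = 1" using False by auto
  also have "z ^ (n + 1) = (z ^ (m + 1)) ^ (CHAR('a) ^ r)" by (simp only: n power_mult mult.commute)
  finally show ?thesis using False power_CHAR_power_eq_1_iff[OF p, of "z ^ (m + 1)" r] by simp
qed

text \<open>The powers of \<open>\<theta>\<close> below \<open>N\<close> are \<open>N\<close>
  distinct roots of \<open>X^N - 1\<close>, which has at most \<open>N\<close> roots, so they
  exhaust them.\<close>

lemma primitive_root_of_unity_power_cases:
  fixes x \<theta> :: "'a::field"
  assumes \<theta>: "primitive_root_of_unity N \<theta>" and x: "x ^ N = 1"
  obtains j where "j < N" "x = \<theta> ^ j"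
proof -
  have N: "N > 0" and \<theta>N: "\<theta> ^ N = 1" and prim: "\<And>j. 0 < j \<Longrightarrow> j < N \<Longrightarrow> \<theta> ^ j \<noteq> 1"
    using \<theta> by (auto simp: primitive_root_of_unity_def)
  have \<theta>0: "\<theta> \<noteq> 0" using \<theta>N N by (auto simp: power_0_left)
  let ?P = "Polynomial.monom 1 N - 1 :: 'a poly"
  have P: "Polynomial.degree ?P \<le> N"
    by (rule degree_diff_le) (auto simp: degree_monom_le)
  have "Polynomial.coeff ?P N = 1" using N by (simp add: coeff_1)
  then have P0: "?P \<noteq> 0" by (metis coeff_0 zero_neq_one)
  have "inj_on (\<lambda>j. \<theta> ^ j) {..<N}"
  proof (rule linorder_inj_onI)
    fix i j assume ij: "i < j" "i \<in> {..<N}" "j \<in> {..<N}"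
    show "\<theta> ^ i \<noteq> \<theta> ^ j"
    proof
      assume "\<theta> ^ i = \<theta> ^ j"
      also have "\<theta> ^ j = \<theta> ^ i * \<theta> ^ (j - i)" using ij by (simp flip: power_add)
      finally have "\<theta> ^ (j - i) = 1" using \<theta>0 by simp
      then show False using prim[of "j - i"] ij by (simp add: less_imp_diff_less)
    qed
  qed auto
  then have "card ((\<lambda>j. \<theta> ^ j) ` {..<N}) = N" by (simp add: card_image)
  moreover have "card {z. poly ?P z = 0} \<le> N"
    using card_poly_roots_bound[OF P0] P by linarith
  moreover have "(\<lambda>j. \<theta> ^ j) ` {..<N} \<subseteq> {z. poly ?P z = 0}"
  proof -
    have "(\<theta> ^ j) ^ N = 1" for j using \<theta>N by (metis mult.commute power_mult power_one)
    then show ?thesis by (auto simp: poly_monom)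
  qed
  ultimately have "(\<lambda>j. \<theta> ^ j) ` {..<N} = {z. poly ?P z = 0}"
    using poly_roots_finite[OF P0] by (metis card_seteq)
  moreover have "poly ?P x = 0" using x by (simp add: poly_monom)
  ultimately show thesis using that by auto
qed

section \<open>The explicit spectrum\<close>

text \<open>Every element of an algebraically closed field has the form \<open>a + b (x + x\<^sup>-\<^sup>1)\<close>; the roots
  of unity \<open>x\<close> that occur are enumerated as \<open>- \<theta> ^ i\<close>, up to inversion.\<close>

lemma eigenvalue_tridiag_toeplitz_roots_of_unity:
  fixes a b \<theta> \<nu> :: "'a::alg_closed_field"
  assumes p: "Factorial_Ring.prime CHAR('a)" and n: "n + 1 = CHAR('a) ^ r * (m + 1)" "n \<ge> 1"
    and m: "\<not> CHAR('a) dvd m + 1" and b: "b \<noteq> 0"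
    and \<theta>: "primitive_root_of_unity (2 * (m + 1)) \<theta>"
  shows "eigenvalue (tridiag_toeplitz n a b b) \<nu> \<longleftrightarrow>
    r \<ge> 1 \<and> \<nu> \<in> {a + 2 * b, a - 2 * b} \<or>
    (\<exists>i. 1 \<le> i \<and> i \<le> m \<and> \<nu> = a - b * (\<theta> ^ i + inverse \<theta> ^ i))"
proof -
  let ?ev = "eigenvalue (tridiag_toeplitz n a b b)"
  have \<theta>N: "\<theta> ^ (2 * (m + 1)) = 1" and prim: "\<And>j. 0 < j \<Longrightarrow> j < 2 * (m + 1) \<Longrightarrow> \<theta> ^ j \<noteq> 1"
    using \<theta> by (auto simp: primitive_root_of_unity_def)
  have \<theta>0: "\<theta> \<noteq> 0" using \<theta>N by (auto simp: power_0_left)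
  have ev_iff: "?ev (a + b * (x + y)) \<longleftrightarrow> (if x\<^sup>2 = 1 then r \<ge> 1 else x ^ (2 * (m + 1)) = 1)"
    if "x * y = 1" for x y
    using eigenvalue_tridiag_toeplitz_iff[OF b n(2) that] geometric_sum_eq_0_iff[OF p n(1) m, of "x\<^sup>2"]
    by (simp only: power_mult)
  show ?thesis
  proof
    assume ev: "?ev \<nu>"
    \<comment> \<open>The value \<open>s\<close> must become \<open>x + inverse x\<close>, so
      \<open>x\<close> is taken as a root of \<open>X^2 - s X + 1\<close>; the other root
      \<open>s - x\<close> is then its inverse.\<close>
    define s where "s = (\<nu> - a) / b"
    obtain x where "poly [:1, -s, 1:] x = 0"
      using alg_closed_imp_poly_has_root[of "[:1, -s, 1:]"] by auto
    then have x1: "x * (s - x) = 1" by (simp add: algebra_simps add_eq_0_iff)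
    have \<nu>: "\<nu> = a + b * (x + (s - x))" using b by (simp add: s_def)
    have y: "s - x = inverse x" using x1 by (metis inverse_unique)
    have \<nu>': "\<nu> = a + b * (x + inverse x)" unfolding y[symmetric] by (rule \<nu>)
    show "r \<ge> 1 \<and> \<nu> \<in> {a + 2 * b, a - 2 * b} \<or>
      (\<exists>i. 1 \<le> i \<and> i \<le> m \<and> \<nu> = a - b * (\<theta> ^ i + inverse \<theta> ^ i))"
    proof (cases "x\<^sup>2 = 1")
      case True
      then have "x = 1 \<or> x = -1" by (simp add: power2_eq_1_iff)
      moreover have "r \<ge> 1" using ev ev_iff[OF x1] True \<nu> by simp
      ultimately show ?thesis unfolding \<nu>' by (auto simp: algebra_simps)
    next
      case False
      then have "x ^ (2 * (m + 1)) = 1" using ev ev_iff[OF x1] \<nu> by simp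
      \<comment> \<open>The exponent is even, so \<open>- x\<close> is a root of unity as well; the
        sign change produces the form \<open>a - b * (...)\<close>.\<close>
      then have "(- x) ^ (2 * (m + 1)) = 1" by simp
      then obtain j where j: "j < 2 * (m + 1)" "- x = \<theta> ^ j"
        using primitive_root_of_unity_power_cases[OF \<theta>] by blast
      have x: "x = - (\<theta> ^ j)" using j(2) by (metis minus_minus)
      \<comment> \<open>At \<open>j = 0\<close> and \<open>j = m + 1\<close> the square of
        \<open>\<theta> ^ j\<close> is 1, which belongs to the case already settled.\<close>
      have "j \<noteq> 0" using False x by (cases j) simp_all
      moreover have "j \<noteq> m + 1" using False x \<theta>N by (auto simp flip: power_mult simp: mult.commute)
      ultimately consider "1 \<le> j" "j \<le> m" | "m + 1 < j" by linarith
      then show ?thesis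
      proof cases
        case 1
        then show ?thesis unfolding \<nu>' x
          by (intro disjI2 exI[of _ j]) (auto simp: power_inverse algebra_simps)
      next
        case 2
        \<comment> \<open>This exponent gives the inverse of \<open>\<theta> ^ j\<close>, and
          \<open>x + inverse x\<close> does not change under inversion.\<close>
        define i where "i = 2 * (m + 1) - j"
        have "\<theta> ^ i * \<theta> ^ j = 1" using j(1) \<theta>N by (simp add: i_def flip: power_add)
        then have "\<theta> ^ j = inverse \<theta> ^ i" by (metis inverse_unique power_inverse)
        moreover have "1 \<le> i" "i \<le> m" using 2 j(1) by (auto simp: i_def)
        ultimately show ?thesis unfolding \<nu>' x
          by (intro disjI2 exI[of _ i]) (auto simp: power_inverse algebra_simps)
      qed
    qed
  next
    assume "r \<ge> 1 \<and> \<nu> \<in> {a + 2 * b, a - 2 * b} \<or>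
      (\<exists>i. 1 \<le> i \<and> i \<le> m \<and> \<nu> = a - b * (\<theta> ^ i + inverse \<theta> ^ i))"
    \<comment> \<open>Each candidate is written as \<open>a + b * (x + y)\<close> with
      \<open>x * y = 1\<close>, for \<open>x\<close> equal to 1, -1 or
      \<open>- (\<theta> ^ i)\<close>.\<close>
    then consider "r \<ge> 1" "\<nu> = a + b * (1 + 1)" | "r \<ge> 1" "\<nu> = a + b * (- 1 + - 1)"
      | i where "1 \<le> i" "i \<le> m" "\<nu> = a + b * (- (\<theta> ^ i) + - (inverse \<theta> ^ i))"
      by (auto simp: algebra_simps)
    then show "?ev \<nu>"
    proof cases
      case 1
      then show ?thesis using ev_iff[of 1 1] by simp
    next
      case 2
      then show ?thesis using ev_iff[of "- 1" "- 1"] by simp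
    next
      case (3 i)
      have "- (\<theta> ^ i) * - (inverse \<theta> ^ i) = 1" using \<theta>0 by (simp add: power_inverse)
      \<comment> \<open>The square is \<open>\<theta> ^ (2 * i)\<close> with
        \<open>0 < 2 * i < 2 * (m + 1)\<close>, so primitivity applies.\<close>
      moreover have "(- (\<theta> ^ i))\<^sup>2 \<noteq> 1"
        using prim[of "i * 2"] 3 by (simp add: power_mult)
      moreover have "(- (\<theta> ^ i)) ^ (2 * (m + 1)) = 1"
        using \<theta>N by (simp only: power_minus_even even_mult_iff even_numeral simp_thms)
          (metis mult.commute power_mult power_one)
      ultimately show ?thesis unfolding 3(3) by (subst ev_iff) auto
    qed
  qed
qed

theorem theorem4p10:
  fixes a b :: "'a::finite_field"
    and f :: "nat \<Rightarrow> 'a poly"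
    and C :: "'a vec set"
    and \<mu> :: "'a alg_closure"
    and p n t r m :: nat
  assumes "CHAR('a) = p" and "odd p"
    and "b \<noteq> 0" and "n \<ge> 2" and "t \<ge> 2"
    and "C = code_of (toeplitz_generator n t a b f)"
    and "n + 1 = p ^ r * (m + 1)"
    and "\<forall>r' m'. n + 1 = p ^ r' * (m' + 1) \<longrightarrow> r' \<le> r"
    and "\<mu> \<in> GF_ext 2" and "\<mu>\<^sup>2 = -1"
  shows
    "(r = 0 \<longrightarrow>
       (\<forall>\<theta> :: 'a alg_closure. primitive_root_of_unity (2 * (n + 1)) \<theta> \<longrightarrow>
          (euclidean_LCD (t * n) C \<longleftrightarrow>
             -1 \<notin> {sum_squares t f (toeplitz_eigenvalue a b \<theta> i) | i. 1 \<le> i \<and> i \<le> n}) \<and>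
          (t = 2 \<longrightarrow>
            (euclidean_LCD (t * n) C \<longleftrightarrow>
               \<mu> \<notin> {poly_ac (f 1) (toeplitz_eigenvalue a b \<theta> i) | i. 1 \<le> i \<and> i \<le> n} \<union>
                   {- poly_ac (f 1) (toeplitz_eigenvalue a b \<theta> i) | i. 1 \<le> i \<and> i \<le> n})))) \<and>
     (r \<ge> 1 \<and> m \<ge> 1 \<longrightarrow>
       (\<forall>\<theta> :: 'a alg_closure. primitive_root_of_unity (2 * (m + 1)) \<theta> \<longrightarrow>
          (euclidean_LCD (t * n) C \<longleftrightarrow>
             -1 \<notin> {sum_squares t f (to_ac (a + 2 * b)), sum_squares t f (to_ac (a - 2 * b))} \<union>
                  {sum_squares t f (toeplitz_eigenvalue a b \<theta> i) | i. 1 \<le> i \<and> i \<le> m}) \<and>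
          (t = 2 \<longrightarrow>
            (euclidean_LCD (t * n) C \<longleftrightarrow>
               \<mu> \<notin> {poly_ac (f 1) (to_ac (a + 2 * b)), - poly_ac (f 1) (to_ac (a + 2 * b)),
                    poly_ac (f 1) (to_ac (a - 2 * b)), - poly_ac (f 1) (to_ac (a - 2 * b))} \<union>
                   {poly_ac (f 1) (toeplitz_eigenvalue a b \<theta> i) | i. 1 \<le> i \<and> i \<le> m} \<union>
                   {- poly_ac (f 1) (toeplitz_eigenvalue a b \<theta> i) | i. 1 \<le> i \<and> i \<le> m})))) \<and>
     (r \<ge> 1 \<and> m = 0 \<longrightarrow>
        (euclidean_LCD (t * n) C \<longleftrightarrow>
           -1 \<notin> {sum_squares t f (to_ac (a + 2 * b)), sum_squares t f (to_ac (a - 2 * b))}) \<and>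
        (t = 2 \<longrightarrow>
          (euclidean_LCD (t * n) C \<longleftrightarrow>
             \<mu> \<notin> {poly_ac (f 1) (to_ac (a + 2 * b)), - poly_ac (f 1) (to_ac (a + 2 * b)),
                  poly_ac (f 1) (to_ac (a - 2 * b)), - poly_ac (f 1) (to_ac (a - 2 * b))})))"
proof -
  let ?LCD = "euclidean_LCD (t * n) C"
  let ?S = "sum_squares t f"
  have p: "Factorial_Ring.prime CHAR('a alg_closure)" by simp
  have n: "n + 1 = CHAR('a alg_closure) ^ r * (m + 1)" using assms(1,7) by simp
  \<comment> \<open>A further factor \<open>p\<close> in \<open>m + 1\<close> would contradict the
    maximality of \<open>r\<close>.\<close>
  have m: "\<not> CHAR('a alg_closure) dvd m + 1"
  proof
    assume "CHAR('a alg_closure) dvd m + 1"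
    then obtain k where k: "m + 1 = p * k" using assms(1) by (auto elim: dvdE)
    then obtain k' where "k = k' + 1" by (cases k) auto
    with k assms(7) have "n + 1 = p ^ Suc r * (k' + 1)" by (simp add: algebra_simps)
    with assms(8) have "Suc r \<le> r" by blast
    then show False by simp
  qed
  \<comment> \<open>A single criterion serves all three cases: the values at
    \<open>a + 2 * b\<close> and \<open>a - 2 * b\<close> drop out for \<open>r = 0\<close>, and the
    range of \<open>i\<close> is empty for \<open>m = 0\<close>.\<close>
  have LCD: "?LCD \<longleftrightarrow> \<not> ((r \<ge> 1 \<and> (?S (to_ac (a + 2 * b)) = -1 \<or> ?S (to_ac (a - 2 * b)) = -1)) \<or>
      (\<exists>i. 1 \<le> i \<and> i \<le> m \<and> ?S (toeplitz_eigenvalue a b \<theta> i) = -1))"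
    if "primitive_root_of_unity (2 * (m + 1)) \<theta>" for \<theta>
  proof -
    have "?LCD \<longleftrightarrow> \<not> (\<exists>x. eigenvalue (tridiag_toeplitz n (to_ac a) (to_ac b) (to_ac b)) x \<and> ?S x = -1)"
      unfolding assms(6) by (rule euclidean_LCD_iff_eigenvalue) (use assms(4,5) in auto)
    also have "eigenvalue (tridiag_toeplitz n (to_ac a) (to_ac b) (to_ac b)) =
      (\<lambda>x. r \<ge> 1 \<and> x \<in> {to_ac (a + 2 * b), to_ac (a - 2 * b)} \<or>
        (\<exists>i. 1 \<le> i \<and> i \<le> m \<and> x = toeplitz_eigenvalue a b \<theta> i))"
      using eigenvalue_tridiag_toeplitz_roots_of_unity[OF p n _ m _ that, of "to_ac b" "to_ac a"] assms(3,4)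
      by (simp add: fun_eq_iff toeplitz_eigenvalue_def)
    finally show ?thesis by blast
  qed
  \<comment> \<open>The case \<open>m = 0\<close> supplies no root of unity, so -1 is used; it
    differs from 1 because the characteristic is odd.\<close>
  have root_minus_1: "primitive_root_of_unity (2 * (0 + 1)) (-1 :: 'a alg_closure)"
  proof -
    have "(-1 :: 'a alg_closure) \<noteq> 1"
    proof
      assume "(-1 :: 'a alg_closure) = 1"
      then have "of_nat 2 = (0 :: 'a alg_closure)" by (simp add: eq_neg_iff_add_eq_0)
      then have "CHAR('a alg_closure) dvd 2" by (simp only: of_nat_eq_0_iff_char_dvd)
      with p have "CHAR('a alg_closure) = 2" by (simp add: primes_dvd_imp_eq)
      with assms(1,2) show False by simp
    qed
    moreover have "0 < j \<and> j < 2 \<longleftrightarrow> j = 1" for j :: nat by auto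
    ultimately show ?thesis by (simp add: primitive_root_of_unity_def)
  qed
  \<comment> \<open>For \<open>t = 2\<close> the sum has the single term \<open>l = 1\<close>, and
    with \<open>\<mu>\<^sup>2 = -1\<close> the condition becomes an equality of two squares.\<close>
  have square: "?S x = -1 \<longleftrightarrow> \<mu> = poly_ac (f 1) x \<or> \<mu> = - poly_ac (f 1) x" if "t = 2" for x
  proof -
    have "?S x = (poly_ac (f 1) x)\<^sup>2" using that by (simp add: sum_squares_def)
    then show ?thesis using assms(10) power2_eq_iff[of \<mu> "poly_ac (f 1) x"] by auto
  qed
  show ?thesis
  proof (intro conjI impI allI)
    fix \<theta> :: "'a alg_closure"
    assume r: "r = 0" and \<theta>: "primitive_root_of_unity (2 * (n + 1)) \<theta>"
    have "m = n" using assms(7) r by simp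
    then have *: "?LCD \<longleftrightarrow> \<not> (\<exists>i. 1 \<le> i \<and> i \<le> n \<and> ?S (toeplitz_eigenvalue a b \<theta> i) = -1)"
      using LCD \<theta> r by simp
    then show "?LCD \<longleftrightarrow> -1 \<notin> {?S (toeplitz_eigenvalue a b \<theta> i) | i. 1 \<le> i \<and> i \<le> n}"
      by (auto simp: eq_commute[of "- 1"])
    assume "t = 2"
    show "?LCD \<longleftrightarrow>
      \<mu> \<notin> {poly_ac (f 1) (toeplitz_eigenvalue a b \<theta> i) | i. 1 \<le> i \<and> i \<le> n} \<union>
           {- poly_ac (f 1) (toeplitz_eigenvalue a b \<theta> i) | i. 1 \<le> i \<and> i \<le> n}"
      unfolding * square[OF \<open>t = 2\<close>] by blast
  next
    fix \<theta> :: "'a alg_closure"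
    assume r: "r \<ge> 1 \<and> m \<ge> 1" and \<theta>: "primitive_root_of_unity (2 * (m + 1)) \<theta>"
    have *: "?LCD \<longleftrightarrow> \<not> (?S (to_ac (a + 2 * b)) = -1 \<or> ?S (to_ac (a - 2 * b)) = -1 \<or>
      (\<exists>i. 1 \<le> i \<and> i \<le> m \<and> ?S (toeplitz_eigenvalue a b \<theta> i) = -1))"
      using LCD[OF \<theta>] r by simp
    then show "?LCD \<longleftrightarrow> -1 \<notin> {?S (to_ac (a + 2 * b)), ?S (to_ac (a - 2 * b))} \<union>
        {?S (toeplitz_eigenvalue a b \<theta> i) | i. 1 \<le> i \<and> i \<le> m}"
      by (auto simp: eq_commute[of "- 1"])
    assume "t = 2"
    show "?LCD \<longleftrightarrow>
      \<mu> \<notin> {poly_ac (f 1) (to_ac (a + 2 * b)), - poly_ac (f 1) (to_ac (a + 2 * b)),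
            poly_ac (f 1) (to_ac (a - 2 * b)), - poly_ac (f 1) (to_ac (a - 2 * b))} \<union>
           {poly_ac (f 1) (toeplitz_eigenvalue a b \<theta> i) | i. 1 \<le> i \<and> i \<le> m} \<union>
           {- poly_ac (f 1) (toeplitz_eigenvalue a b \<theta> i) | i. 1 \<le> i \<and> i \<le> m}"
      unfolding * square[OF \<open>t = 2\<close>] by blast
  next
    assume r: "r \<ge> 1 \<and> m = 0"
    have *: "?LCD \<longleftrightarrow> \<not> (?S (to_ac (a + 2 * b)) = -1 \<or> ?S (to_ac (a - 2 * b)) = -1)"
      using LCD[of "-1"] root_minus_1 r by simp
    then show "?LCD \<longleftrightarrow> -1 \<notin> {?S (to_ac (a + 2 * b)), ?S (to_ac (a - 2 * b))}"
      by (auto simp: eq_commute[of "- 1"])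
    assume "t = 2"
    show "?LCD \<longleftrightarrow>
      \<mu> \<notin> {poly_ac (f 1) (to_ac (a + 2 * b)), - poly_ac (f 1) (to_ac (a + 2 * b)),
            poly_ac (f 1) (to_ac (a - 2 * b)), - poly_ac (f 1) (to_ac (a - 2 * b))}"
      unfolding * square[OF \<open>t = 2\<close>] by blast
  qed
qed

end
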